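(* For each $r \in \{13, 17, 20, 21, 24\}$ there exists a pentagonal geometry $\mathrm{PENT}(4,r)$ with no opposite line pairs whose deficiency graph is connected and has girth at least $5$.
   Context: A partial linear space is a non-empty finite set of points together with a collection of subsets, called lines (or blocks), such that every line contains at least two points and any two distinct points lie together on at most one line. Two distinct points are collinear if some line contains both. For integers $k \ge 2$, $r \ge 1$, a pentagonal geometry $\mathrm{PENT}(k,r)$ is a partial linear space in which every line contains exactly $k$ points, every point lies on exactly $r$ lines, and for each point $x$ there is a line, denoted $x^{\mathrm{opp}}$, consisting of precisely those points $y \ne x$ that are not collinear with $x$. An opposite line pair is an unordered pair of disjoint lines such that for each point $x$ on one of the two lines, $x^{\mathrm{opp}}$ is the other line. The deficiency graph of a pentagonal geometry has the points as vertices, with an edge joining distinct points $x$ and $y$ precisely when $x$ and $y$ are not collinear. *)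

theory Defs
  imports "Graph_Theory.Graph_Theory" "HOL-Library.Extended_Nat"
begin

locale partial_linear_space =
  fixes V :: "'a set" and L :: "'a set set"
  assumes finite_points: "finite V"
    and points_nonempty: "V \<noteq> {}"
    and line_subset: "l \<in> L \<Longrightarrow> l \<subseteq> V"
    and line_card_ge_2: "l \<in> L \<Longrightarrow> 2 \<le> card l"
    and line_unique: "\<lbrakk>x \<in> V; y \<in> V; x \<noteq> y; l \<in> L; m \<in> L; {x, y} \<subseteq> l; {x, y} \<subseteq> m\<rbrakk> \<Longrightarrow> l = m"

definition collinear :: "'a set set \<Rightarrow> 'a \<Rightarrow> 'a \<Rightarrow> bool" where
  "collinear L x y \<longleftrightarrow> x \<noteq> y \<and> (\<exists>l\<in>L. x \<in> l \<and> y \<in> l)"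

text \<open>In an arbitrary partial linear space \<open>opp V L x\<close> is just a set of points; that it is
  always a line is the defining property of a pentagonal geometry.\<close>

definition opp :: "'a set \<Rightarrow> 'a set set \<Rightarrow> 'a \<Rightarrow> 'a set" where
  "opp V L x = {y \<in> V. y \<noteq> x \<and> \<not> collinear L x y}"

locale PENT = partial_linear_space V L
  for k r :: nat and V :: "'a set" and L :: "'a set set" +
  assumes k_ge_2: "2 \<le> k"
    and r_ge_1: "1 \<le> r"
    and line_card: "l \<in> L \<Longrightarrow> card l = k"
    and point_degree: "x \<in> V \<Longrightarrow> card {l \<in> L. x \<in> l} = r"
    and opp_line: "x \<in> V \<Longrightarrow> opp V L x \<in> L"

text \<open>The relation is symmetric in \<open>l\<close> and \<open>m\<close>, so it describes unordered pairs.\<close>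

definition opposite_line_pair :: "'a set \<Rightarrow> 'a set set \<Rightarrow> 'a set \<Rightarrow> 'a set \<Rightarrow> bool" where
  "opposite_line_pair V L l m \<longleftrightarrow>
     l \<in> L \<and> m \<in> L \<and> l \<inter> m = {} \<and> (\<forall>x\<in>l. opp V L x = m) \<and> (\<forall>x\<in>m. opp V L x = l)"

text \<open>Following the AFP entry Graph Theory, a simple graph is a symmetric loop-free digraph:
  every edge is represented by its two orientations.\<close>

definition deficiency_graph :: "'a set \<Rightarrow> 'a set set \<Rightarrow> 'a pair_pre_digraph" where
  "deficiency_graph V L =
     \<lparr>pverts = V, parcs = {(x, y). x \<in> V \<and> y \<in> V \<and> x \<noteq> y \<and> \<not> collinear L x y}\<rparr>"

lemma pair_graph_deficiency_graph:
  assumes "finite V"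
  shows "pair_graph (deficiency_graph V L)"
proof unfold_locales
  show "finite (parcs (deficiency_graph V L))"
    by (rule finite_subset[of _ "V \<times> V"]) (use assms in \<open>auto simp: deficiency_graph_def\<close>)
  have "sym {(x, y). x \<in> V \<and> y \<in> V \<and> x \<noteq> y \<and> \<not> collinear L x y}"
    by (rule symI) (auto simp: collinear_def)
  then show "symmetric (with_proj (deficiency_graph V L))"
    by (simp add: symmetric_def arcs_ends_def arc_to_ends_def deficiency_graph_def)
qed (use assms in \<open>simp_all add: deficiency_graph_def split_beta\<close>)

text \<open>Meant for simple graphs represented as above. The directed notion
  \<open>pre_digraph.cycle\<close> also admits the walk that traverses one edge back and forth, which is not
  a cycle of the undirected graph; hence the bound on the length. The girth of an acyclic graph
  is \<open>\<infinity>\<close>, the infimum of the empty set.\<close>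

definition girth :: "'a pair_pre_digraph \<Rightarrow> enat" where
  "girth G = (INF p \<in> {p. pre_digraph.cycle (with_proj G) p \<and> 3 \<le> length p}. enat (length p))"

end

theory Submission
  imports Defs "HOL-Number_Theory.Cong"
begin

text \<open>A \<open>PENT(4,r)\<close> has \<open>v = 3r + 5\<close> points. Each of the five geometries lives on the integers modulo
  \<open>v\<close>, is invariant under translation by a divisor \<open>m\<close> of \<open>v\<close>, and is given by base lines, so its
  axioms need checking only at the points \<open>0, \<dots>, m - 1\<close>. At such a point \<open>x\<close> the check is that
  \<open>x\<close>, the four points of \<open>x\<^sup>o\<^sup>p\<^sup>p\<close> and the remaining points of the lines through \<open>x\<close> partition
  all the points. The deficiency graph never has triangles, because \<open>x\<^sup>o\<^sup>p\<^sup>p\<close> is a line; it has no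
  4-cycle, and the geometry no opposite line pair, as soon as two neighbours of \<open>x\<close> have only \<open>x\<close>
  as a common neighbour. It is connected because every point other than 0 has a smaller neighbour.\<close>

subsection \<open>Girth and opposite line pairs from common neighbours\<close>

context PENT
begin

lemma mem_opp_sym: "x \<in> V \<Longrightarrow> y \<in> opp V L x \<Longrightarrow> x \<in> opp V L y"
  by (auto simp: opp_def collinear_def)

text \<open>The set \<open>opp V L x\<close> is itself a line, so any two of its points are
  collinear and hence not adjacent in the deficiency graph.\<close>

lemma opp_triangle_free:
  assumes "x \<in> V" "y \<in> opp V L x" "z \<in> opp V L x"
  shows "z \<notin> opp V L y"
proof
  assume z: "z \<in> opp V L y"
  then have "y \<noteq> z" by (auto simp: opp_def)
  then have "collinear L y z"
    using opp_line[OF assms(1)] assms(2,3) unfolding collinear_def by blast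
  with z show False by (simp add: opp_def)
qed

lemma arc_deficiency_graph_iff:
  "e \<in> arcs (with_proj (deficiency_graph V L)) \<longleftrightarrow> fst e \<in> V \<and> snd e \<in> opp V L (fst e)"
  by (cases e) (auto simp: deficiency_graph_def opp_def)

text \<open>Only lengths 3 and 4 have to be excluded. A 3-cycle contradicts
  \<open>opp_triangle_free\<close>; in a 4-cycle through \<open>u\<close> the vertex across from
  \<open>u\<close> would be a second common neighbour of two neighbours of \<open>u\<close>.\<close>

lemma girth_deficiency_graph_ge_5:
  assumes common: "\<And>x a b y. x \<in> V \<Longrightarrow> a \<in> opp V L x \<Longrightarrow> b \<in> opp V L x \<Longrightarrow> a \<noteq> b \<Longrightarrow>
      y \<in> opp V L a \<Longrightarrow> y \<in> opp V L b \<Longrightarrow> y = x"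
  shows "girth (deficiency_graph V L) \<ge> 5"
proof -
  let ?G = "with_proj (deficiency_graph V L)"
  have "5 \<le> length p" if cycle: "pre_digraph.cycle ?G p" and len: "3 \<le> length p" for p
  proof (rule ccontr)
    obtain u where arcs: "set p \<subseteq> arcs ?G" and cas: "pre_digraph.cas ?G u p u"
      and dist: "distinct (tl (pre_digraph.awalk_verts ?G u p))"
      using cycle by (auto simp: pre_digraph.cycle_def pre_digraph.awalk_def)
    have arc: "fst e \<in> V" "snd e \<in> opp V L (fst e)" if "e \<in> set p" for e
      using arcs that arc_deficiency_graph_iff by blast+
    assume "\<not> 5 \<le> length p"
    with len consider "length p = 3" | "length p = 4" by linarith
    then show False
    proof cases
      case 1
      then obtain e f g where p: "p = [e, f, g]"
        by (auto simp: numeral_3_eq_3 length_Suc_conv)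
      have eqs: "fst e = u" "fst f = snd e" "fst g = snd f" "snd g = u"
        using cas by (auto simp: p pre_digraph.cas.simps)
      have "u \<in> V" "snd e \<in> opp V L u" "snd f \<in> opp V L (snd e)" "snd f \<in> opp V L u"
        using arc[of e] arc[of f] arc[of g] mem_opp_sym[of "snd f" u] by (simp_all add: p eqs)
      then show False
        using opp_triangle_free by blast
    next
      case 2
      then obtain e f g h where p: "p = [e, f, g, h]"
        by (auto simp: numeral_eq_Suc length_Suc_conv)
      have eqs: "fst e = u" "fst f = snd e" "fst g = snd f" "fst h = snd g" "snd h = u"
        using cas by (auto simp: p pre_digraph.cas.simps)
      \<comment> \<open>Without its first vertex the closed walk visits \<open>snd e\<close>,
        \<open>snd f\<close>, \<open>snd g\<close>, \<open>u\<close>, and a cycle visits each of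
        these only once.\<close>
      have "snd e \<noteq> snd g" "snd f \<noteq> u"
        using dist eqs by (auto simp: p pre_digraph.awalk_verts.simps)
      moreover have "u \<in> V" "snd e \<in> opp V L u" "snd f \<in> opp V L (snd e)"
        "snd f \<in> opp V L (snd g)" "snd g \<in> opp V L u"
        using arc[of e] arc[of f] arc[of g] arc[of h] mem_opp_sym[of "snd g" u]
          mem_opp_sym[of "snd f" "snd g"] by (simp_all add: p eqs)
      ultimately show False
        using common[of u "snd e" "snd g" "snd f"] by blast
    qed
  qed
  then show ?thesis
    unfolding girth_def by (intro INF_greatest) (auto simp: numeral_eq_enat)
qed

text \<open>Two points \<open>x\<close>, \<open>y\<close> of \<open>l\<close> and two points
  \<open>a\<close>, \<open>b\<close> of \<open>m\<close> would form a 4-cycle of the deficiency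
  graph.\<close>

lemma no_opposite_line_pair:
  assumes common: "\<And>x a b y. x \<in> V \<Longrightarrow> a \<in> opp V L x \<Longrightarrow> b \<in> opp V L x \<Longrightarrow> a \<noteq> b \<Longrightarrow>
      y \<in> opp V L a \<Longrightarrow> y \<in> opp V L b \<Longrightarrow> y = x"
  shows "\<not> opposite_line_pair V L l m"
proof
  assume *: "opposite_line_pair V L l m"
  then have l: "l \<in> L" and m: "m \<in> L" by (auto simp: opposite_line_pair_def)
  \<comment> \<open>Here \<open>k\<close> is a line; it shadows the line size.\<close>
  have two_points: "\<exists>x\<in>k. \<exists>y\<in>k. x \<noteq> y" if "k \<in> L" for k
    using line_card_ge_2[OF that] card_le_Suc0_iff_eq[OF finite_subset[OF line_subset[OF that] finite_points]]
    by auto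
  obtain x y where xy: "x \<in> l" "y \<in> l" "x \<noteq> y"
    using two_points[OF l] by blast
  obtain a b where ab: "a \<in> m" "b \<in> m" "a \<noteq> b"
    using two_points[OF m] by blast
  have "x \<in> V" using xy line_subset[OF l] by auto
  then show False
    using * xy ab common[of x a b y] by (auto simp: opposite_line_pair_def)
qed

end

subsection \<open>Geometries developed from base lines\<close>

definition shift :: "nat \<Rightarrow> nat \<Rightarrow> nat \<Rightarrow> nat" where
  "shift v s z = (z + s) mod v"

text \<open>The amount \<open>s\<close> may exceed \<open>v\<close>: \<open>shift\<close> reduces
  modulo \<open>v\<close>, so for \<open>m\<close> dividing \<open>v\<close> this yields the same
  lines as the multiples of \<open>m\<close> below \<open>v\<close>.\<close>

definition developed_lines :: "nat \<Rightarrow> nat \<Rightarrow> nat list list \<Rightarrow> nat set set" where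
  "developed_lines v m bs = {shift v s ` set b | s b. m dvd s \<and> b \<in> set bs}"

text \<open>The shift is the one that takes \<open>y\<close> to \<open>p\<close>; adding \<open>v\<close> keeps the subtraction from truncating.\<close>

definition lines_through :: "nat \<Rightarrow> nat \<Rightarrow> nat list list \<Rightarrow> nat \<Rightarrow> nat list list" where
  "lines_through v m bs p =
     [map (shift v (v + p - y)) (remove1 y b). b \<leftarrow> bs, y \<leftarrow> b, y mod m = p mod m]"

text \<open>The deficiency graph is stored only at the residues modulo \<open>m\<close>; translation
  invariance extends it to all points.\<close>

definition neighbours :: "nat \<Rightarrow> nat \<Rightarrow> nat list list \<Rightarrow> nat \<Rightarrow> nat list" where
  "neighbours v m N p = map (shift v (p - p mod m)) (N ! (p mod m))"

lemma mem_lines_through: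
  "a \<in> set (lines_through v m bs p) \<longleftrightarrow>
    (\<exists>b\<in>set bs. \<exists>y\<in>set b. y mod m = p mod m \<and> a = map (shift v (v + p - y)) (remove1 y b))"
  by (auto simp: lines_through_def)

section \<open>Translations modulo \<open>v\<close>\<close>

lemma shift_less: "0 < v \<Longrightarrow> shift v s z < v"
  by (simp add: shift_def)

lemma shift_shift: "shift v s (shift v t z) = shift v (t + s) z"
  by (simp add: shift_def mod_simps add.assoc)

text \<open>Both sides reduce to \<open>s\<close> and \<open>t\<close> being congruent modulo
  \<open>v\<close>. Translations written with different shift amounts can thus be identified by
  comparing them at a single point.\<close>

lemma shift_eq_transfer:
  assumes "shift v s y = shift v t y"
  shows "shift v s z = shift v t z"
  using assms cong_add_lcancel_nat[of y s t v] cong_add_lcancel_nat[of z s t v]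
  by (simp add: shift_def cong_def)

lemma inj_on_shift: "inj_on (shift v s) {..<v}"
proof (rule inj_onI)
  fix x y assume "x \<in> {..<v}" "y \<in> {..<v}" "shift v s x = shift v s y"
  then show "x = y"
    using cong_add_rcancel_nat[of x s y v] by (simp add: shift_def cong_def)
qed

lemma shift_image: "0 < v \<Longrightarrow> shift v s ` {..<v} = {..<v}"
  by (intro endo_inj_surj inj_on_shift) (auto simp: shift_less)

lemma shift_mod: "m dvd v \<Longrightarrow> m dvd s \<Longrightarrow> shift v s z mod m = z mod m"
  by (auto simp: shift_def mod_mod_cancel)

lemma shift_to: "p < v \<Longrightarrow> y < v \<Longrightarrow> shift v (v + p - y) y = p"
  by (simp add: shift_def)

text \<open>For the numerical checks of the five geometries: these rules unfold ranges whose lower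
  end is \<open>0\<close> or \<open>Suc 0\<close> (the simplified form of \<open>1\<close>) into
  explicit lists.\<close>

lemma upt_numeral:
  "[0..<numeral k] = 0 # [Suc 0..<numeral k]"
  "[Suc 0..<numeral k] = (if Suc 0 < numeral k then Suc 0 # [2..<numeral k] else [])"
  by (simp_all add: upt_conv_Cons numeral_2_eq_2)

lemma distinct_concat_disjoint:
  assumes "distinct (concat xss)" "xs \<in> set xss" "ys \<in> set xss" "xs \<noteq> ys"
  shows "set xs \<inter> set ys = {}"
  using assms by (auto simp: distinct_concat_iff)

lemma distinct_concat_map_disjoint:
  assumes "distinct (concat (map f xs))" "x \<in> set xs" "y \<in> set xs" "x \<noteq> y"
  shows "set (f x) \<inter> set (f y) = {}"
  using assms by (induction xs) auto

text \<open>The \<open>x\<close>-th entry of \<open>N\<close> is the line opposite to \<open>x < m\<close>; \<open>C\<close> lists the base lines that are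
  not opposite to any point.\<close>

locale base_lines =
  fixes v m r :: nat and N C :: "nat list list"
  assumes v_pos: "0 < v" and m_pos: "0 < m" and m_dvd: "m dvd v" and r_pos: "0 < r"
    and length_N: "length N = m"
    and base_list: "list_all (\<lambda>b. length b = 4 \<and> distinct b \<and> list_all (\<lambda>z. z < v) b) (N @ C)"
    and partition_list: "list_all (\<lambda>x. sort (x # neighbours v m N x @ concat (lines_through v m (N @ C) x)) =
      [0..<v]) [0..<m]"
    and degree_list: "list_all (\<lambda>x. length (lines_through v m (N @ C) x) = r) [0..<m]"
    and common_list: "list_all (\<lambda>x. distinct (concat (map (\<lambda>a. remove1 x (neighbours v m N a))
      (neighbours v m N x)))) [0..<m]"
    and descent_list: "list_all (\<lambda>p. list_ex (\<lambda>q. q < p) (neighbours v m N p)) [1..<v]"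
begin

abbreviation "\<sigma> \<equiv> shift v"
abbreviation "bs \<equiv> N @ C"
abbreviation "V \<equiv> {..<v}"
abbreviation "L \<equiv> developed_lines v m bs"
abbreviation "nb \<equiv> neighbours v m N"
abbreviation "thru \<equiv> lines_through v m bs"

lemma base_D: "b \<in> set bs \<Longrightarrow> length b = 4" "b \<in> set bs \<Longrightarrow> distinct b"
  "b \<in> set bs \<Longrightarrow> z \<in> set b \<Longrightarrow> z < v"
  using base_list by (auto simp: list_all_iff)

lemma partition: "x < m \<Longrightarrow> sort (x # nb x @ concat (thru x)) = [0..<v]"
  using partition_list by (simp add: list_all_iff)

lemma degree: "x < m \<Longrightarrow> length (thru x) = r"
  using degree_list by (simp add: list_all_iff)

lemma common: "x < m \<Longrightarrow> distinct (concat (map (\<lambda>a. remove1 x (nb a)) (nb x)))"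
  using common_list by (simp add: list_all_iff)

lemma descent: "0 < p \<Longrightarrow> p < v \<Longrightarrow> \<exists>q\<in>set (nb p). q < p"
  using descent_list by (simp add: list_all_iff list_ex_iff)

lemma N_in_base: "N ! (p mod m) \<in> set bs"
  using length_N m_pos by simp

lemma m_le_v: "m \<le> v"
  using m_dvd v_pos by (rule dvd_imp_le)

lemma mod_less_v: "p mod m < v"
  using m_pos m_le_v by (meson less_le_trans mod_less_divisor)

lemma representative: "p < v \<Longrightarrow> \<sigma> (p - p mod m) (p mod m) = p"
  by (simp add: shift_def)

section \<open>Translation invariance of neighbours and lines\<close>

lemma neighbours_shift:
  assumes "m dvd s" "p < v"
  shows "nb (\<sigma> s p) = map (\<sigma> s) (nb p)"
proof -
  \<comment> \<open>The translations by \<open>\<sigma> s p - p mod m\<close> and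
    \<open>p - p mod m + s\<close> are compared at the representative \<open>p mod m\<close>;
    agreement there gives agreement everywhere.\<close>
  have "\<sigma> (\<sigma> s p - p mod m) (p mod m) = \<sigma> s p"
    using representative[of "\<sigma> s p"] assms by (simp add: shift_mod m_dvd shift_less v_pos)
  also have "\<dots> = \<sigma> (p - p mod m + s) (p mod m)"
    using representative[OF assms(2)] by (metis shift_shift)
  finally have "\<sigma> (\<sigma> s p - p mod m) z = \<sigma> s (\<sigma> (p - p mod m) z)" for z
    using shift_eq_transfer by (metis shift_shift)
  then show ?thesis
    using assms by (simp add: neighbours_def shift_mod m_dvd)
qed

lemma lines_through_shift:
  assumes "m dvd s" "p < v"
  shows "thru (\<sigma> s p) = map (map (\<sigma> s)) (thru p)"
proof -
  have "\<sigma> (v + \<sigma> s p - y) z = \<sigma> s (\<sigma> (v + p - y) z)" if "y < v" for y z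
  proof -
    have "\<sigma> (v + \<sigma> s p - y) y = \<sigma> (v + p - y + s) y"
      using that assms v_pos by (metis shift_to shift_less shift_shift)
    then show ?thesis
      using shift_eq_transfer by (metis shift_shift)
  qed
  \<comment> \<open>The conditional is what the filter of the list comprehension in
    \<open>lines_through\<close> unfolds to.\<close>
  then have "(if y mod m = \<sigma> s p mod m then [map (\<sigma> (v + \<sigma> s p - y)) (remove1 y b)] else []) =
      map (map (\<sigma> s)) (if y mod m = p mod m then [map (\<sigma> (v + p - y)) (remove1 y b)] else [])"
    if "b \<in> set bs" "y \<in> set b" for b y
    using that assms base_D(3) by (simp add: shift_mod m_dvd)
  then show ?thesis
    unfolding lines_through_def map_concat map_map o_def
    by (intro arg_cong[of _ _ concat] map_cong refl) auto
qed

text \<open>For a residue, sorting to \<open>[0..<v]\<close> says that each point occurs exactly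
  once. The row of \<open>p\<close> is a translate of the row of \<open>p mod m\<close>, and a
  translation permutes the points.\<close>

lemma partition_at:
  assumes "p < v"
  shows "distinct (p # nb p @ concat (thru p))" "set (p # nb p @ concat (thru p)) = V"
proof -
  let ?x = "p mod m" let ?s = "p - p mod m"
  let ?row = "\<lambda>p. p # nb p @ concat (thru p)"
  have sort: "sort (?row ?x) = [0..<v]"
    using partition m_pos by simp
  have x: "distinct (?row ?x)" "set (?row ?x) = V"
    using arg_cong[OF sort, of distinct] arg_cong[OF sort, of set]
    by (simp_all only: distinct_sort set_sort distinct_upt set_upt atLeast_upt)
  have p: "p = \<sigma> ?s ?x" and s: "m dvd ?s"
    using representative[OF assms] by (simp_all add: dvd_minus_mod)
  have row: "?row p = map (\<sigma> ?s) (?row ?x)"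
    using neighbours_shift[OF s mod_less_v, of p] lines_through_shift[OF s mod_less_v, of p]
    by (simp only: p[symmetric] list.map map_append map_concat)
  show "distinct (?row p)"
    unfolding row distinct_map using x inj_on_shift by simp
  show "set (?row p) = V"
    unfolding row set_map x(2) by (rule shift_image[OF v_pos])
qed

lemma degree_at:
  assumes "p < v"
  shows "length (thru p) = r"
  using lines_through_shift[of "p - p mod m" "p mod m"] representative[OF assms] degree m_pos mod_less_v
  by (simp add: dvd_minus_mod)

text \<open>Three points remain of a base line after \<open>y\<close> is removed. Since they are
  nonempty, disjoint entries are also different.\<close>

lemma lines_through_nonempty:
  assumes "a \<in> set (thru p)"
  shows "set a \<noteq> {}"
proof -
  obtain b y where "b \<in> set bs" "y \<in> set b" and a: "a = map (\<sigma> (v + p - y)) (remove1 y b)"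
    using assms unfolding mem_lines_through by blast
  then have "length a = 3"
    using base_D(1) by (simp add: length_remove1)
  then show ?thesis by auto
qed

section \<open>Developed lines and their incidence with points\<close>

lemma developed_line_subset: "l \<in> L \<Longrightarrow> l \<subseteq> V"
  using v_pos by (auto simp: developed_lines_def shift_less)

lemma developed_line_card: "l \<in> L \<Longrightarrow> card l = 4"
proof -
  assume "l \<in> L"
  then obtain s b where l: "l = \<sigma> s ` set b" and b: "b \<in> set bs"
    by (auto simp: developed_lines_def)
  have "inj_on (\<sigma> s) (set b)"
    by (rule inj_on_subset[OF inj_on_shift]) (use base_D(3)[OF b] in auto)
  then show "card l = 4"
    using base_D(1,2)[OF b] by (simp add: l card_image distinct_card)
qed

text \<open>If a translation takes a point \<open>y\<close> of a base line to \<open>p\<close>, it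
  is the translation by \<open>v + p - y\<close>. Each entry of \<open>lines_through\<close> omits
  \<open>p\<close>, which is put back here.\<close>

lemma developed_lines_containing:
  assumes p: "p < v"
  shows "{l \<in> L. p \<in> l} = (\<lambda>a. insert p (set a)) ` set (thru p)"
proof (intro equalityI subsetI)
  fix l assume "l \<in> {l \<in> L. p \<in> l}"
  then obtain s b y where l: "l = \<sigma> s ` set b" and s: "m dvd s" and b: "b \<in> set bs"
    and y: "y \<in> set b" "p = \<sigma> s y"
    by (auto simp: developed_lines_def)
  have yv: "y < v" using base_D(3) b y by blast
  have "\<sigma> (v + p - y) y = \<sigma> s y"
    using shift_to[OF p yv] y by simp
  then have eq: "\<sigma> (v + p - y) z = \<sigma> s z" for z
    by (rule shift_eq_transfer)
  have "set (map (\<sigma> (v + p - y)) (remove1 y b)) = \<sigma> s ` (set b - {y})"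
    using base_D(2)[OF b] by (simp add: eq)
  then have "l = insert p (set (map (\<sigma> (v + p - y)) (remove1 y b)))"
    using y by (auto simp only: l)
  moreover have "map (\<sigma> (v + p - y)) (remove1 y b) \<in> set (thru p)"
    unfolding mem_lines_through using b y shift_mod[OF m_dvd s, of y] by metis
  ultimately show "l \<in> (\<lambda>a. insert p (set a)) ` set (thru p)"
    by blast
next
  fix l assume "l \<in> (\<lambda>a. insert p (set a)) ` set (thru p)"
  then obtain a where a: "a \<in> set (thru p)" "l = insert p (set a)"
    by blast
  then obtain b y where b: "b \<in> set bs" and y: "y \<in> set b" "y mod m = p mod m"
    and l: "l = insert p (set (map (\<sigma> (v + p - y)) (remove1 y b)))"
    unfolding mem_lines_through by blast
  have yv: "y < v" using base_D(3) b y by blast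
  have "l = \<sigma> (v + p - y) ` set b"
    using y base_D(2)[OF b] shift_to[OF p yv] by (force simp: l)
  moreover have "m dvd v + p - y"
  proof -
    have "(v + p) mod m = y mod m"
      using y m_dvd by (auto simp: mod_add_eq elim!: dvdE)
    then show ?thesis
      using yv by (simp add: mod_eq_dvd_iff_nat)
  qed
  ultimately have "l \<in> L"
    using b by (auto simp: developed_lines_def)
  then show "l \<in> {l \<in> L. p \<in> l}"
    using l by simp
qed

lemma lines_through_disjoint:
  assumes "p < v" "a \<in> set (thru p)" "b \<in> set (thru p)" "a \<noteq> b"
  shows "set a \<inter> set b = {}"
  using partition_at(1)[OF assms(1)] assms by (intro distinct_concat_disjoint) auto

lemma distinct_lines_through:
  assumes "p < v"
  shows "distinct (thru p)"
proof -
  \<comment> \<open>Distinctness of a concatenation rules out repeated entries only among the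
    nonempty ones.\<close>
  have "removeAll [] (thru p) = thru p"
    using lines_through_nonempty by (intro removeAll_id) force
  moreover have "distinct (concat (thru p))"
    using partition_at(1)[OF assms] by simp
  ultimately show ?thesis
    by (metis distinct_concat_iff)
qed

lemma not_in_lines_through: "p < v \<Longrightarrow> a \<in> set (thru p) \<Longrightarrow> p \<notin> set a"
  using partition_at(1) by auto

lemma collinear_iff:
  assumes "p < v"
  shows "collinear L p y \<longleftrightarrow> y \<in> set (concat (thru p))"
proof -
  have "collinear L p y \<longleftrightarrow> p \<noteq> y \<and> (\<exists>l\<in>{l \<in> L. p \<in> l}. y \<in> l)"
    by (auto simp: collinear_def)
  also have "\<dots> \<longleftrightarrow> y \<in> set (concat (thru p))"
    using not_in_lines_through[OF assms]
    by (auto simp: developed_lines_containing[OF assms])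
  finally show ?thesis .
qed

text \<open>By \<open>partition_at\<close>, the points other than \<open>p\<close> split into the
  neighbours and the points on lines through \<open>p\<close>; the latter are those collinear with
  \<open>p\<close>.\<close>

lemma opp_eq_neighbours:
  assumes "p < v"
  shows "opp V L p = set (nb p)"
  using partition_at[OF assms] by (auto simp: opp_def collinear_iff[OF assms])

section \<open>Axioms of a pentagonal geometry\<close>

lemma PENT_developed: "PENT 4 r V L"
proof
  show "finite V" "V \<noteq> {}" using v_pos by auto
  show "l \<subseteq> V" "2 \<le> card l" "card l = 4" if "l \<in> L" for l
    using that developed_line_subset developed_line_card[OF that] by auto
  show "l = l'" if "x \<in> V" "y \<in> V" "x \<noteq> y" "l \<in> L" "l' \<in> L" "{x, y} \<subseteq> l" "{x, y} \<subseteq> l'"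
    for x y l l'
  proof -
    have x: "x < v" using that by simp
    have "l \<in> {l \<in> L. x \<in> l}" "l' \<in> {l \<in> L. x \<in> l}" using that by auto
    then obtain a b where ab: "a \<in> set (thru x)" "b \<in> set (thru x)"
      "l = insert x (set a)" "l' = insert x (set b)"
      unfolding developed_lines_containing[OF x] by blast
    then have "y \<in> set a \<inter> set b" using that by auto
    then show ?thesis using lines_through_disjoint[OF x ab(1,2)] ab by auto
  qed
  show "card {l \<in> L. x \<in> l} = r" if "x \<in> V" for x
  proof -
    have x: "x < v" using that by simp
    \<comment> \<open>Different entries are disjoint and nonempty, so counting entries counts
      lines.\<close>
    have "inj_on (\<lambda>a. insert x (set a)) (set (thru x))"
    proof (rule inj_onI)
      fix a b assume ab: "a \<in> set (thru x)" "b \<in> set (thru x)" "insert x (set a) = insert x (set b)"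
      then have "set a = set b" using not_in_lines_through[OF x] by (metis insert_ident)
      then show "a = b"
        using ab lines_through_disjoint[OF x] lines_through_nonempty by fastforce
    qed
    then show ?thesis
      using distinct_lines_through[OF x] degree_at[OF x]
      by (simp add: developed_lines_containing[OF x] card_image distinct_card)
  qed
  show "opp V L x \<in> L" if "x \<in> V" for x
  proof -
    \<comment> \<open>This is a translate of a row of \<open>N\<close>, and the rows of
      \<open>N\<close> are among the base lines.\<close>
    have "opp V L x = \<sigma> (x - x mod m) ` set (N ! (x mod m))"
      using that by (simp add: opp_eq_neighbours neighbours_def)
    then show ?thesis
      using N_in_base[of x] dvd_minus_mod[of m x] unfolding developed_lines_def by blast
  qed
qed (use r_pos in auto)

section \<open>Common neighbours and connectedness\<close>

lemma neighbours_less: "p < v \<Longrightarrow> a \<in> set (nb p) \<Longrightarrow> a < v"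
  using partition_at(2) by fastforce

text \<open>Translating by a multiple of \<open>m\<close> moves the configuration to the residue
  \<open>p mod m\<close>, where the finite check \<open>common\<close> applies.\<close>

lemma common_neighbour:
  assumes p: "p < v" and ab: "a \<in> set (nb p)" "b \<in> set (nb p)" "a \<noteq> b"
    and y: "y \<in> set (nb a)" "y \<in> set (nb b)"
  shows "y = p"
proof -
  let ?x = "p mod m" let ?s = "p - p mod m"
  have s: "m dvd ?s" and px: "\<sigma> ?s ?x = p"
    using representative[OF p] by (simp_all add: dvd_minus_mod)
  have nb: "set (nb (\<sigma> ?s q)) = \<sigma> ?s ` set (nb q)" if "q < v" for q
    using neighbours_shift[OF s that] by simp
  obtain a' b' where ab': "a' \<in> set (nb ?x)" "b' \<in> set (nb ?x)" "a = \<sigma> ?s a'" "b = \<sigma> ?s b'"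
    using ab nb[OF mod_less_v, of p] by (auto simp: px)
  then have less: "a' < v" "b' < v" using neighbours_less mod_less_v by blast+
  obtain y' y'' where y': "y' \<in> set (nb a')" "y = \<sigma> ?s y'" "y'' \<in> set (nb b')" "y = \<sigma> ?s y''"
    using y ab' nb less by auto
  then have "y'' = y'"
    using neighbours_less less inj_onD[OF inj_on_shift, of v ?s y'' y'] by auto
  \<comment> \<open>Once \<open>?x\<close> is removed, different neighbours of \<open>?x\<close>
    have disjoint neighbourhoods, so a shared neighbour must be \<open>?x\<close>.\<close>
  moreover have "set (remove1 ?x (nb a')) \<inter> set (remove1 ?x (nb b')) = {}"
    using common m_pos ab' ab by (intro distinct_concat_map_disjoint[of _ "nb ?x"]) auto
  ultimately have "y' = ?x"
    using y' by (metis disjoint_iff in_set_remove1)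
  then show ?thesis using y' px by simp
qed

lemma connected_developed: "connected (with_proj (deficiency_graph V L))"
proof -
  let ?G = "with_proj (deficiency_graph V L)"
  interpret P: PENT 4 r V L by (rule PENT_developed)
  interpret pair_graph "deficiency_graph V L"
    by (rule pair_graph_deficiency_graph) simp
  have adj: "(p, q) \<in> parcs (deficiency_graph V L)" if "p < v" "q \<in> set (nb p)" for p q
    using that opp_eq_neighbours[of p] by (auto simp: deficiency_graph_def opp_def)
  have zero: "p \<rightarrow>\<^sup>*\<^bsub>?G\<^esub> 0" if "p < v" for p
    using that
  proof (induction p rule: less_induct)
    case (less p)
    show ?case
    proof (cases "p = 0")
      case True
      then show ?thesis using v_pos reachable_refl[of 0] by (simp add: True deficiency_graph_def)
    next
      case False
      then obtain q where "q \<in> set (nb p)" "q < p"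
        using descent[of p] less.prems by auto
      then show ?thesis
        using adj_reachable_trans[OF adj] less.IH less.prems less_trans by blast
    qed
  qed
  \<comment> \<open>All arcs occur in both directions, so the descents to 0 can be reversed and
    joined. Strong connectedness then passes to the symmetric closure, by which
    \<open>connected\<close> is defined.\<close>
  have "strongly_connected ?G"
  proof (rule strongly_connectedI)
    show "verts ?G \<noteq> {}" using v_pos by (auto simp: deficiency_graph_def)
    fix p q assume "p \<in> verts ?G" "q \<in> verts ?G"
    then have "p < v" "q < v" by (simp_all add: deficiency_graph_def)
    then show "p \<rightarrow>\<^sup>*\<^bsub>?G\<^esub> q"
      using zero symmetric_reachable[OF sym_arcs] reachable_trans by blast
  qed
  then show ?thesis
    using reachable_mk_symmetricI unfolding connected_def strongly_connected_def by auto
qed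

lemma developed_geometry:
  "\<exists>(V :: nat set) L. PENT 4 r V L \<and> (\<nexists>l m. opposite_line_pair V L l m) \<and>
     connected (with_proj (deficiency_graph V L)) \<and> girth (deficiency_graph V L) \<ge> 5"
proof -
  interpret P: PENT 4 r V L by (rule PENT_developed)
  have "y = x" if "x \<in> V" "a \<in> opp V L x" "b \<in> opp V L x" "a \<noteq> b" "y \<in> opp V L a" "y \<in> opp V L b"
    for x a b y
    using that common_neighbour[of x a b y] by (auto simp: opp_eq_neighbours neighbours_less)
  then show ?thesis
    using PENT_developed connected_developed P.girth_deficiency_graph_ge_5 P.no_opposite_line_pair
    by blast
qed

end

subsection \<open>Base lines for the five geometries\<close>

text \<open>The lists were found by computer: the neighbourhoods \<open>N\<close> come from a random
  translation-invariant 4-regular graph of girth at least 5, and the lines \<open>C\<close> from an exact cover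
  of the pairs at distance at least 3 in that graph. The points were then relabelled so that every
  nonzero point has a smaller neighbour.\<close>

definition N13 :: "nat list list" where
  "N13 =
    [[1, 2, 4, 40], [0, 3, 7, 18], [0, 19, 29, 39], [1, 10, 30, 41]]"

definition C13 :: "nat list list" where
  "C13 =
    [[0, 9, 31, 34], [0, 10, 16, 33], [0, 11, 20, 43], [0, 12, 26, 27], [0, 13, 21, 37],
    [0, 22, 25, 30], [1, 13, 31, 39], [1, 15, 38, 43], [2, 6, 15, 34]]"

definition N17 :: "nat list list" where
  "N17 =
    [[1, 2, 3, 51], [0, 4, 5, 44], [0, 6, 7, 15], [0, 8, 20, 47], [1, 17, 43, 46],
    [1, 6, 47, 54], [2, 5, 13, 20], [2, 19, 21, 50]]"

definition C17 :: "nat list list" where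
  "C17 =
    [[0, 9, 27, 36], [0, 10, 25, 38], [0, 11, 30, 45], [0, 13, 16, 37], [0, 14, 26, 49],
    [0, 17, 34, 41], [0, 18, 42, 52], [0, 19, 29, 54], [0, 22, 32, 55], [0, 28, 33, 43],
    [0, 31, 35, 50], [1, 7, 35, 39], [1, 9, 37, 53], [1, 10, 36, 55], [1, 12, 21, 38],
    [1, 13, 15, 31], [1, 20, 23, 26], [2, 4, 18, 38], [2, 11, 35, 53], [2, 14, 31, 37],
    [2, 23, 45, 54], [3, 4, 15, 36], [3, 14, 19, 46], [3, 23, 28, 53], [3, 29, 39, 52],
    [4, 6, 12, 22]]"

definition N20 :: "nat list list" where
  "N20 =
    [[1, 2, 51, 61], [0, 3, 5, 15], [0, 4, 19, 59], [1, 28, 43, 59], [2, 12, 13, 52]]"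

definition C20 :: "nat list list" where
  "C20 =
    [[0, 6, 30, 44], [0, 7, 13, 48], [0, 8, 12, 26], [0, 9, 32, 54], [0, 11, 31, 64],
    [0, 16, 27, 45], [0, 17, 22, 25], [0, 18, 21, 52], [0, 23, 28, 56], [0, 24, 29, 43],
    [0, 33, 39, 42], [0, 34, 38, 58], [0, 37, 46, 49], [1, 8, 9, 44], [1, 13, 23, 42],
    [1, 14, 27, 47], [1, 18, 29, 31], [1, 19, 37, 58], [1, 22, 26, 49], [2, 9, 37, 53]]"

definition N21 :: "nat list list" where
  "N21 =
    [[1, 2, 9, 66], [0, 3, 59, 60], [0, 4, 27, 47], [1, 13, 26, 46]]"

definition C21 :: "nat list list" where
  "C21 =
    [[0, 5, 31, 39], [0, 6, 7, 12], [0, 10, 18, 28], [0, 13, 45, 48], [0, 14, 38, 52],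
    [0, 15, 41, 46], [0, 17, 34, 61], [0, 19, 36, 57], [0, 22, 37, 55], [0, 24, 49, 53],
    [0, 26, 35, 42], [1, 7, 39, 53], [1, 10, 22, 41], [1, 11, 30, 51], [1, 15, 21, 67],
    [2, 7, 31, 34], [2, 15, 19, 30]]"

definition N24 :: "nat list list" where
  "N24 =
    [[1, 2, 3, 73], [0, 4, 29, 50], [0, 5, 37, 44], [0, 7, 18, 74], [1, 5, 10, 66],
    [2, 4, 6, 76], [5, 12, 34, 55]]"

definition C24 :: "nat list list" where
  "C24 =
    [[0, 6, 23, 39], [0, 8, 14, 45], [0, 9, 22, 75], [0, 10, 40, 48], [0, 12, 57, 72],
    [0, 13, 21, 53], [0, 15, 25, 33], [0, 16, 59, 68], [0, 17, 19, 65], [0, 20, 35, 61],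
    [0, 24, 27, 49], [0, 30, 38, 51], [0, 34, 47, 66], [0, 36, 41, 43], [0, 46, 58, 76],
    [0, 54, 60, 64], [1, 9, 34, 59], [1, 12, 46, 69], [1, 13, 39, 75], [1, 15, 40, 61],
    [1, 17, 48, 72], [1, 18, 27, 37], [1, 20, 36, 58], [1, 24, 41, 52], [1, 25, 30, 45],
    [1, 31, 51, 60], [1, 44, 55, 67], [2, 12, 26, 30], [2, 16, 46, 53], [2, 34, 38, 48],
    [3, 4, 45, 53], [3, 17, 40, 68], [3, 25, 47, 67], [3, 27, 46, 62], [4, 18, 33, 68]]"

text \<open>The first pass expands the range of base points, so that the definitions are unfolded in the
  second pass at numerals only.\<close>

lemma base_lines_13: "base_lines 44 4 13 N13 C13"
  by unfold_locales
    (simp_all add: upt_numeral,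
     simp_all add: upt_numeral lines_through_def neighbours_def shift_def N13_def C13_def)

lemma base_lines_17: "base_lines 56 8 17 N17 C17"
  by unfold_locales
    (simp_all add: upt_numeral,
     simp_all add: upt_numeral lines_through_def neighbours_def shift_def N17_def C17_def)

lemma base_lines_20: "base_lines 65 5 20 N20 C20"
  by unfold_locales
    (simp_all add: upt_numeral,
     simp_all add: upt_numeral lines_through_def neighbours_def shift_def N20_def C20_def)

lemma base_lines_21: "base_lines 68 4 21 N21 C21"
  by unfold_locales
    (simp_all add: upt_numeral,
     simp_all add: upt_numeral lines_through_def neighbours_def shift_def N21_def C21_def)

lemma base_lines_24: "base_lines 77 7 24 N24 C24"
  by unfold_locales
    (simp_all add: upt_numeral,
     simp_all add: upt_numeral lines_through_def neighbours_def shift_def N24_def C24_def)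

theorem lemma3p1:
  shows "\<forall>r \<in> {13, 17, 20, 21, 24}. \<exists>(V :: nat set) L.
           PENT 4 r V L \<and>
           (\<nexists>l m. opposite_line_pair V L l m) \<and>
           connected (with_proj (deficiency_graph V L)) \<and>
           girth (deficiency_graph V L) \<ge> 5"
  using base_lines_13[THEN base_lines.developed_geometry]
    base_lines_17[THEN base_lines.developed_geometry]
    base_lines_20[THEN base_lines.developed_geometry]
    base_lines_21[THEN base_lines.developed_geometry]
    base_lines_24[THEN base_lines.developed_geometry]
  by simp

end
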